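(* Let $g_1,\ldots,g_m\in\mathbb{R}[x]$ and $\mathbf{K}=\{x\in\mathbb{R}^n: g_j(x)\geq0,\ j=1,\ldots,m\}$. Assume that $\mathbf{K}$ is compact, that the polynomial $x\mapsto a^2-\|x\|^2$ belongs to the quadratic module $Q(g)$ for some $a\in\mathbb{R}$, and that $\mathbf{K}\subset\mathbf{B}\subseteq[-1,1]^n$ with $\mathbf{B}$ a Borel set. Let $\mu_2$ be the normalized Lebesgue measure on $\mathbf{B}$, $\mu_2(\mathbf{C})=\mathrm{vol}(\mathbf{C})/2^n$ for Borel $\mathbf{C}\subseteq\mathbf{B}$, with moment sequence $\mathbf{y}_2=(y_{2\alpha})_{\alpha\in\mathbb{N}^n}$, $y_{2\alpha}=\int x^\alpha\,d\mu_2$. Let $p\in\mathbb{R}[x]$ be positive almost everywhere on $\mathbf{K}$. Put $r_0=\lceil(\deg p)/2\rceil$ and $r_j=\lceil(\deg g_j)/2\rceil$ for $j=1,\ldots,m$. For every integer $d\geq\max_{0\le j\le m}r_j$ consider the semidefinite program $$\mathrm{Q}_d:\quad\left\{\begin{array}{lll}\displaystyle\sup_{\mathbf{y}_1}&L_{\mathbf{y}_1}(p)&\\ \text{s.t.}&M_d(\mathbf{y}_1)&\succeq0\\ &M_d(\mathbf{y}_2-\mathbf{y}_1)&\succeq0\\ &M_{d-r_j}(g_j\,\mathbf{y}_1)&\succeq0,\qquad j=1,\ldots,m,\end{array}\right.$$ where the unknown is $\mathbf{y}_1=(y_{1\alpha})_{|\alpha|\leq2d}$ with real entries. Then: (a)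 $\mathrm{Q}_d$ has an optimal solution (so its optimal value is a maximum, denoted $\max\mathrm{Q}_d$), and $\max\mathrm{Q}_d\downarrow\int_{\mathbf{K}}p\,d\mu_2$ as $d\to\infty$ (monotone non-increasing convergence). (b) If, for each $d$, $\mathbf{y}_1^d=(y^d_{1\alpha})$ is an optimal solution of $\mathrm{Q}_d$, then $$\lim_{d\to\infty}y^d_{1\alpha}=\int_{\mathbf{K}}x^\alpha\,d\mu_2\qquad\text{for every }\alpha\in\mathbb{N}^n.$$
   Context: $\mathbb{R}[x]$ is the ring of real polynomials in $x=(x_1,\ldots,x_n)$ and $\Sigma^2[x]\subset\mathbb{R}[x]$ is the set of sums of squares of polynomials. The quadratic module generated by $g_1,\ldots,g_m$ is $Q(g)=\{\sigma_0+\sum_{j=1}^m\sigma_jg_j:\sigma_0,\ldots,\sigma_m\in\Sigma^2[x]\}$. For $\alpha\in\mathbb{N}^n$, $|\alpha|=\sum_i\alpha_i$ and $\mathbb{N}^n_d=\{\alpha\in\mathbb{N}^n:|\alpha|\leq d\}$. For a real family $\mathbf{y}=(y_\alpha)$ indexed by exponents, $L_{\mathbf{y}}$ is the linear functional $L_{\mathbf{y}}(\sum_\alpha f_\alpha x^\alpha)=\sum_\alpha f_\alpha y_\alpha$. The moment matrix $M_d(\mathbf{y})$ is the symmetric matrix indexed by $\alpha,\beta\in\mathbb{N}^n_d$ with entries $M_d(\mathbf{y})(\alpha,\beta)=y_{\alpha+\beta}$. For $g=\sum_\gamma g_\gamma x^\gamma\in\mathbb{R}[x]$, the localizing matrix $M_d(g\,\mathbf{y})$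 is the symmetric matrix indexed by $\alpha,\beta\in\mathbb{N}^n_d$ with entries $L_{\mathbf{y}}(g(x)x^{\alpha+\beta})=\sum_\gamma g_\gamma y_{\alpha+\beta+\gamma}$. $A\succeq0$ means $A$ is positive semidefinite. In $M_d(\mathbf{y}_2-\mathbf{y}_1)$, $\mathbf{y}_2$ is truncated to $|\alpha|\le 2d$. "Almost everywhere" is with respect to Lebesgue measure. *)

theory Defs
  imports "HOL-Analysis.Analysis" "HOL-Library.Poly_Mapping" "HOL-Library.FuncSet"
begin

text \<open>
  The variables are indexed by a finite type \<open>'n\<close>, so the number of variables is \<open>CARD('n)\<close>.
  An exponent in \<open>\<nat>\<^sup>n\<close> is a finitely supported map from \<open>'n\<close> to \<open>nat\<close>, and a polynomial is
  a finitely supported map from exponents to coefficients; multiplication of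
  polynomials is the convolution product of \<open>Poly_Mapping\<close>.
\<close>

type_synonym 'n expo = "'n \<Rightarrow>\<^sub>0 nat"
type_synonym 'n mpoly = "'n expo \<Rightarrow>\<^sub>0 real"

abbreviation monom :: "'n expo \<Rightarrow> 'n mpoly" where
  "monom \<alpha> \<equiv> Poly_Mapping.single \<alpha> 1"

definition expo_eval :: "'n::finite expo \<Rightarrow> real ^ 'n \<Rightarrow> real" where
  "expo_eval \<alpha> x = (\<Prod>i\<in>UNIV. (x $ i) ^ Poly_Mapping.lookup \<alpha> i)"

definition peval :: "'n::finite mpoly \<Rightarrow> real ^ 'n \<Rightarrow> real" where
  "peval f x = (\<Sum>\<alpha>\<in>Poly_Mapping.keys f. Poly_Mapping.lookup f \<alpha> * expo_eval \<alpha> x)"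

definition expo_deg :: "'n::finite expo \<Rightarrow> nat" where
  "expo_deg \<alpha> = (\<Sum>i\<in>UNIV. Poly_Mapping.lookup \<alpha> i)"

text \<open>Total degree; the zero polynomial gets degree 0.\<close>

definition total_deg :: "'n::finite mpoly \<Rightarrow> nat" where
  "total_deg f = Max (insert 0 (expo_deg ` Poly_Mapping.keys f))"

definition half_deg :: "'n::finite mpoly \<Rightarrow> nat" where
  "half_deg f = nat \<lceil>real (total_deg f) / 2\<rceil>"

definition expos_upto :: "nat \<Rightarrow> 'n::finite expo set" where
  "expos_upto d = {\<alpha>. expo_deg \<alpha> \<le> d}"

lemma finite_expos_upto: "finite (expos_upto d :: 'n::finite expo set)"
proof -
  have "Poly_Mapping.lookup ` (expos_upto d :: 'n expo set) \<subseteq> UNIV \<rightarrow>\<^sub>E {..d}"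
  proof
    fix f assume "f \<in> Poly_Mapping.lookup ` (expos_upto d :: 'n expo set)"
    then obtain \<alpha> :: "'n expo" where \<alpha>: "expo_deg \<alpha> \<le> d" "f = Poly_Mapping.lookup \<alpha>"
      by (auto simp: expos_upto_def)
    have "f i \<le> d" for i
      using member_le_sum[of i UNIV f] \<alpha> by (simp add: expo_deg_def)
    then show "f \<in> UNIV \<rightarrow>\<^sub>E {..d}" by auto
  qed
  then have "finite (Poly_Mapping.lookup ` (expos_upto d :: 'n expo set))"
    by (rule finite_subset) (simp add: finite_PiE)
  then show ?thesis
    by (rule finite_imageD) (simp add: inj_on_def)
qed

definition sos :: "'n mpoly set" where
  "sos = {f. \<exists>(k::nat) h. f = (\<Sum>i<k. (h i)\<^sup>2)}"

definition quadratic_module :: "(nat \<Rightarrow> 'n mpoly) \<Rightarrow> nat \<Rightarrow> 'n mpoly set" where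
  "quadratic_module g m =
     {\<sigma> 0 + (\<Sum>j=1..m. \<sigma> j * g j) |\<sigma>. \<forall>j\<le>m. \<sigma> j \<in> sos}"

definition semialg :: "(nat \<Rightarrow> 'n::finite mpoly) \<Rightarrow> nat \<Rightarrow> (real ^ 'n) set" where
  "semialg g m = {x. \<forall>j\<in>{1..m}. peval (g j) x \<ge> 0}"

definition ball_poly :: "real \<Rightarrow> 'n::finite mpoly" where
  "ball_poly a =
     Poly_Mapping.single 0 (a\<^sup>2) - (\<Sum>i\<in>UNIV. monom (Poly_Mapping.single i 2))"

definition riesz :: "('n expo \<Rightarrow> real) \<Rightarrow> 'n mpoly \<Rightarrow> real" where
  "riesz y f = (\<Sum>\<alpha>\<in>Poly_Mapping.keys f. Poly_Mapping.lookup f \<alpha> * y \<alpha>)"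

text \<open>
  A matrix indexed by exponents is a function of two exponents; its size, which is the
  subscript of \<open>M\<^sub>d\<close>, is given by the index set in the semidefiniteness condition.
\<close>

definition psd_on :: "'i set \<Rightarrow> ('i \<Rightarrow> 'i \<Rightarrow> real) \<Rightarrow> bool" where
  "psd_on I A \<longleftrightarrow>
     (\<forall>i\<in>I. \<forall>j\<in>I. A i j = A j i) \<and>
     (\<forall>v :: 'i \<Rightarrow> real. (\<Sum>i\<in>I. \<Sum>j\<in>I. v i * A i j * v j) \<ge> 0)"

definition moment_matrix :: "('n expo \<Rightarrow> real) \<Rightarrow> 'n expo \<Rightarrow> 'n expo \<Rightarrow> real" where
  "moment_matrix y \<alpha> \<beta> = y (\<alpha> + \<beta>)"

definition localizing_matrix ::
  "'n mpoly \<Rightarrow> ('n expo \<Rightarrow> real) \<Rightarrow> 'n expo \<Rightarrow> 'n expo \<Rightarrow> real" where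
  "localizing_matrix g y \<alpha> \<beta> = riesz y (g * monom (\<alpha> + \<beta>))"

definition normalized_lebesgue :: "(real ^ 'n::finite) set \<Rightarrow> (real ^ 'n) measure" where
  "normalized_lebesgue B =
     scale_measure (ennreal (1 / 2 ^ CARD('n))) (restrict_space lborel B)"

definition moments :: "(real ^ 'n::finite) measure \<Rightarrow> 'n expo \<Rightarrow> real" where
  "moments M \<alpha> = (LINT x|M. expo_eval \<alpha> x)"

text \<open>
  A family \<open>(y\<^sub>\<alpha>)\<close> with \<open>\<bar>\<alpha>\<bar> \<le> 2d\<close> is a function that is \<open>undefined\<close> outside
  \<open>expos_upto (2 * d)\<close>. For \<open>d\<close> at least \<open>min_order g m p\<close>, no constraint and no
  objective value depends on an entry outside this set.
\<close>

definition feasible ::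
  "(nat \<Rightarrow> 'n::finite mpoly) \<Rightarrow> nat \<Rightarrow> (real ^ 'n) set \<Rightarrow> nat \<Rightarrow> ('n expo \<Rightarrow> real) \<Rightarrow> bool" where
  "feasible g m B d y1 \<longleftrightarrow>
     y1 \<in> extensional (expos_upto (2 * d)) \<and>
     psd_on (expos_upto d) (moment_matrix y1) \<and>
     psd_on (expos_upto d)
       (moment_matrix (\<lambda>\<alpha>. moments (normalized_lebesgue B) \<alpha> - y1 \<alpha>)) \<and>
     (\<forall>j\<in>{1..m}. psd_on (expos_upto (d - half_deg (g j))) (localizing_matrix (g j) y1))"

definition optimal ::
  "(nat \<Rightarrow> 'n::finite mpoly) \<Rightarrow> nat \<Rightarrow> (real ^ 'n) set \<Rightarrow> 'n mpoly \<Rightarrow> nat \<Rightarrow>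
     ('n expo \<Rightarrow> real) \<Rightarrow> bool" where
  "optimal g m B p d = is_arg_max (\<lambda>y. riesz y p) (feasible g m B d)"

definition opt_value ::
  "(nat \<Rightarrow> 'n::finite mpoly) \<Rightarrow> nat \<Rightarrow> (real ^ 'n) set \<Rightarrow> 'n mpoly \<Rightarrow> nat \<Rightarrow> real" where
  "opt_value g m B p d = (SUP y\<in>Collect (feasible g m B d). riesz y p)"

definition min_order :: "(nat \<Rightarrow> 'n::finite mpoly) \<Rightarrow> nat \<Rightarrow> 'n mpoly \<Rightarrow> nat" where
  "min_order g m p = Max (insert (half_deg p) ((\<lambda>j. half_deg (g j)) ` {1..m}))"

end

theory Submission
  imports Defs
begin

text \<open>
  Let \<open>\<mu>\<close> be the normalized Lebesgue measure on \<open>B\<close>, let \<open>K\<close> be the set defined by the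
  constraints \<open>g\<close>, and let \<open>L\<close> be the linear functional of a sequence \<open>y\<close> that is feasible at
  order \<open>d\<close>. The two moment matrix constraints say that \<open>0 \<le> L(h\<^sup>2) \<le> \<integral>h\<^sup>2 d\<mu>\<close> for all
  \<open>h\<close> of degree at most \<open>d\<close>. If this held for all \<open>h\<close>, then \<open>L\<close> would be continuous on
  \<open>L\<^sup>2(\<mu>)\<close> and hence integration against a density \<open>\<phi>\<close> with \<open>0 \<le> \<phi> \<le> 1\<close>; the localizing
  constraints would give \<open>g j * \<phi> \<ge> 0\<close>, so that \<open>\<phi>\<close> vanishes off \<open>K\<close>. The consequence that
  matters is the inequality \<open>L(f) \<le> \<integral>\<^sub>K max 0 f d\<mu>\<close> for every polynomial \<open>f\<close>. The density
  is only a heuristic: lemma \<open>eventually_le_positive_part\<close> proves the inequality directly, with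
  an arbitrarily small error, at all sufficiently large orders and uniformly over the feasible
  sequences, from a certificate

    \<open>f \<le> s - \<Sum>j. (v j)\<^sup>2 * g j + error\<close>

  on the box, whose ingredients \<open>s \<ge> 0\<close> and \<open>v j\<close> come from the Weierstrass theorem. The
  passage from semidefiniteness to positivity on nonnegative polynomials is lemma
  \<open>eventually_dominated_nonneg\<close>.

  Apply this inequality to \<open>f = p + t q\<close> with small \<open>t > 0\<close>. It gives
  \<open>L(p) + t L(q) \<le> \<integral>\<^sub>K max 0 (p + t q) d\<mu>\<close> up to a small error. An optimal solution has
  \<open>L(p) \<ge> \<integral>\<^sub>K p d\<mu>\<close>, because the moments of the restriction of \<open>\<mu>\<close> to \<open>K\<close> are feasible;
  and since \<open>p > 0\<close> almost everywhere on \<open>K\<close>, the right-hand side has the value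
  \<open>\<integral>\<^sub>K p d\<mu>\<close> and the derivative \<open>\<integral>\<^sub>K q d\<mu>\<close> at \<open>t = 0\<close>. Hence
  \<open>L(q) \<le> \<integral>\<^sub>K q d\<mu>\<close> in the limit, and replacing \<open>q\<close> by \<open>- q\<close> yields equality (lemma
  \<open>near_optimal_tendsto\<close>). Monomials \<open>q\<close> give the convergence of the moments, and \<open>q = p\<close>
  gives the limit of the optimal values.

  Existence of optimal solutions is compactness: the entries of a feasible sequence are bounded
  by 1 (lemma \<open>abs_dominated_le_1\<close>). Monotonicity holds because truncation maps feasible
  sequences of a higher order to feasible sequences of a lower one (lemma \<open>feasible_restrict\<close>).
\<close>

section \<open>Polynomials and linear functionals on them\<close>

lemma riesz_superset:
  assumes "finite I" "Poly_Mapping.keys f \<subseteq> I"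
  shows "riesz y f = (\<Sum>\<alpha>\<in>I. Poly_Mapping.lookup f \<alpha> * y \<alpha>)"
  unfolding riesz_def using assms by (intro sum.mono_neutral_left) (auto simp: in_keys_iff)

lemma riesz_zero [simp]: "riesz y 0 = 0"
  by (simp add: riesz_def)

lemma riesz_add: "riesz y (f + h) = riesz y f + riesz y h"
proof -
  let ?I = "Poly_Mapping.keys f \<union> Poly_Mapping.keys h"
  have "riesz y (f + h) = (\<Sum>\<alpha>\<in>?I. Poly_Mapping.lookup (f + h) \<alpha> * y \<alpha>)"
    by (rule riesz_superset) (auto dest: set_mp[OF keys_add])
  also have "\<dots> = (\<Sum>\<alpha>\<in>?I. Poly_Mapping.lookup f \<alpha> * y \<alpha>) + (\<Sum>\<alpha>\<in>?I. Poly_Mapping.lookup h \<alpha> * y \<alpha>)"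
    by (simp add: lookup_add distrib_right sum.distrib)
  also have "\<dots> = riesz y f + riesz y h"
    by (simp add: riesz_superset[of ?I])
  finally show ?thesis .
qed

lemma riesz_uminus: "riesz y (- f) = - riesz y f"
  using riesz_add[of y f "- f"] by simp

lemma riesz_diff: "riesz y (f - h) = riesz y f - riesz y h"
  using riesz_add[of y f "- h"] by (simp add: riesz_uminus)

lemma riesz_sum: "riesz y (\<Sum>i\<in>I. F i) = (\<Sum>i\<in>I. riesz y (F i))"
  by (induction I rule: infinite_finite_induct) (simp_all add: riesz_add)

lemma riesz_single [simp]: "riesz y (Poly_Mapping.single \<alpha> c) = c * y \<alpha>"
  by (subst riesz_superset[of "{\<alpha>}"]) auto

lemma riesz_one [simp]: "riesz y 1 = y 0"
  using riesz_single[of y 0 1] by simp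

lemma riesz_diff_sequence: "riesz (\<lambda>\<alpha>. z \<alpha> - y \<alpha>) f = riesz z f - riesz y f"
  by (simp add: riesz_def right_diff_distrib sum_subtractf)

lemma poly_expansion:
  fixes f :: "'n mpoly"
  assumes "finite I" "Poly_Mapping.keys f \<subseteq> I"
  shows "f = (\<Sum>\<alpha>\<in>I. Poly_Mapping.single \<alpha> (Poly_Mapping.lookup f \<alpha>))"
proof (rule poly_mapping_eqI)
  fix \<beta>
  have "(\<Sum>\<alpha>\<in>I. Poly_Mapping.lookup (Poly_Mapping.single \<alpha> (Poly_Mapping.lookup f \<alpha>)) \<beta>)
      = (\<Sum>\<alpha>\<in>I. if \<beta> = \<alpha> then Poly_Mapping.lookup f \<beta> else 0)"
    by (intro sum.cong) (auto simp: lookup_single)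
  also have "\<dots> = Poly_Mapping.lookup f \<beta>"
    using assms by (auto simp: in_keys_iff)
  finally show "Poly_Mapping.lookup f \<beta> =
      Poly_Mapping.lookup (\<Sum>\<alpha>\<in>I. Poly_Mapping.single \<alpha> (Poly_Mapping.lookup f \<alpha>)) \<beta>"
    by (simp add: lookup_sum)
qed

lemma riesz_scale: "riesz y (Poly_Mapping.single 0 c * f) = c * riesz y f"
proof -
  have f: "f = (\<Sum>\<alpha>\<in>Poly_Mapping.keys f. Poly_Mapping.single \<alpha> (Poly_Mapping.lookup f \<alpha>))"
    by (rule poly_expansion) auto
  have "riesz y (Poly_Mapping.single 0 c * f) =
     (\<Sum>\<alpha>\<in>Poly_Mapping.keys f. c * (Poly_Mapping.lookup f \<alpha> * y \<alpha>))"
    by (subst f) (simp add: sum_distrib_left riesz_sum mult_single algebra_simps)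
  then show ?thesis
    by (simp add: riesz_def sum_distrib_left)
qed

text \<open>
  The bridge from matrices to functionals: the quadratic form of a localizing matrix at the
  coefficient vector of \<open>h\<close> is the functional at \<open>q h\<^sup>2\<close>. Moment matrices are the case
  \<open>q = 1\<close>.
\<close>

lemma riesz_mult_square:
  fixes y :: "'n expo \<Rightarrow> real"
  assumes "finite I" "Poly_Mapping.keys h \<subseteq> I"
  shows "riesz y (q * (h * h)) =
    (\<Sum>\<alpha>\<in>I. \<Sum>\<beta>\<in>I. Poly_Mapping.lookup h \<alpha> * localizing_matrix q y \<alpha> \<beta> * Poly_Mapping.lookup h \<beta>)"
proof -
  let ?s = "\<lambda>\<alpha>. Poly_Mapping.single \<alpha> (Poly_Mapping.lookup h \<alpha>) :: 'n mpoly"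
  have summand: "riesz y (q * (?s \<alpha> * ?s \<beta>)) =
      Poly_Mapping.lookup h \<alpha> * localizing_matrix q y \<alpha> \<beta> * Poly_Mapping.lookup h \<beta>" for \<alpha> \<beta>
  proof -
    have "q * (?s \<alpha> * ?s \<beta>) =
        Poly_Mapping.single 0 (Poly_Mapping.lookup h \<alpha> * Poly_Mapping.lookup h \<beta>) *
        (q * monom (\<alpha> + \<beta>))"
      by (simp add: mult_single mult.left_commute)
    then show ?thesis
      by (simp add: riesz_scale localizing_matrix_def)
  qed
  have h: "h = (\<Sum>\<alpha>\<in>I. ?s \<alpha>)"
    using assms by (rule poly_expansion)
  have "h * h = (\<Sum>\<alpha>\<in>I. \<Sum>\<beta>\<in>I. ?s \<alpha> * ?s \<beta>)"
    by (subst (1 2) h) (simp add: sum_product)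
  then show ?thesis
    by (simp add: sum_distrib_left riesz_sum summand)
qed

lemma localizing_matrix_one: "localizing_matrix 1 y = moment_matrix y"
  by (simp add: fun_eq_iff localizing_matrix_def moment_matrix_def)

lemma riesz_mult_square_nonneg:
  assumes "psd_on (expos_upto d) (localizing_matrix q y)" "Poly_Mapping.keys h \<subseteq> expos_upto d"
  shows "0 \<le> riesz y (q * (h * h))"
  using assms by (simp add: riesz_mult_square[OF finite_expos_upto] psd_on_def)

lemma riesz_square_nonneg:
  assumes "psd_on (expos_upto d) (moment_matrix y)" "Poly_Mapping.keys h \<subseteq> expos_upto d"
  shows "0 \<le> riesz y (h * h)"
  using riesz_mult_square_nonneg[of d 1 y h] assms by (simp add: localizing_matrix_one)

lemma psd_on_subset:
  assumes "psd_on I A" "finite I" "J \<subseteq> I" "\<And>i j. i \<in> J \<Longrightarrow> j \<in> J \<Longrightarrow> A' i j = A i j"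
  shows "psd_on J A'"
  unfolding psd_on_def
proof (intro conjI allI ballI)
  show "A' i j = A' j i" if "i \<in> J" "j \<in> J" for i j
    using that assms by (auto simp: psd_on_def subset_iff)
  fix v :: "'a \<Rightarrow> real"
  let ?w = "\<lambda>i. if i \<in> J then v i else 0"
  have "(\<Sum>i\<in>J. \<Sum>j\<in>J. v i * A' i j * v j) = (\<Sum>i\<in>J. \<Sum>j\<in>J. ?w i * A i j * ?w j)"
    using assms by (intro sum.cong) auto
  also have "\<dots> = (\<Sum>i\<in>J. \<Sum>j\<in>I. ?w i * A i j * ?w j)"
    using assms by (intro sum.cong sum.mono_neutral_left refl) auto
  also have "\<dots> = (\<Sum>i\<in>I. \<Sum>j\<in>I. ?w i * A i j * ?w j)"
    using assms by (intro sum.mono_neutral_left) auto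
  also have "\<dots> \<ge> 0"
    using assms(1) by (simp only: psd_on_def)
  finally show "0 \<le> (\<Sum>i\<in>J. \<Sum>j\<in>J. v i * A' i j * v j)" .
qed

lemma expo_eval_add: "expo_eval (\<alpha> + \<beta>) x = expo_eval \<alpha> x * expo_eval \<beta> x"
  by (simp add: expo_eval_def lookup_add power_add prod.distrib)

lemma expo_eval_zero [simp]: "expo_eval 0 x = 1"
  by (simp add: expo_eval_def)

lemma peval_eq_riesz: "peval f x = riesz (\<lambda>\<alpha>. expo_eval \<alpha> x) f"
  by (simp add: peval_def riesz_def)

lemma peval_single [simp]: "peval (Poly_Mapping.single \<alpha> c) x = c * expo_eval \<alpha> x"
  by (simp add: peval_eq_riesz)

lemma peval_one [simp]: "peval 1 x = 1"
  by (simp add: peval_eq_riesz)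

lemma peval_add [simp]: "peval (f + h) x = peval f x + peval h x"
  by (simp add: peval_eq_riesz riesz_add)

lemma peval_diff [simp]: "peval (f - h) x = peval f x - peval h x"
  by (simp add: peval_eq_riesz riesz_diff)

lemma peval_sum [simp]: "peval (\<Sum>i\<in>I. F i) x = (\<Sum>i\<in>I. peval (F i) x)"
  by (simp add: peval_eq_riesz riesz_sum)

lemma peval_mult [simp]: "peval (f * h) x = peval f x * peval h x"
proof -
  have expand: "q = (\<Sum>\<alpha>\<in>Poly_Mapping.keys q. Poly_Mapping.single \<alpha> (Poly_Mapping.lookup q \<alpha>))"
    for q :: "'a mpoly"
    by (rule poly_expansion) auto
  have "f * h = (\<Sum>\<alpha>\<in>Poly_Mapping.keys f. \<Sum>\<beta>\<in>Poly_Mapping.keys h.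
      Poly_Mapping.single (\<alpha> + \<beta>) (Poly_Mapping.lookup f \<alpha> * Poly_Mapping.lookup h \<beta>))"
    by (subst expand[of f], subst expand[of h]) (simp only: sum_product mult_single)
  then show ?thesis
    by (simp add: expo_eval_add) (simp add: peval_def sum_product mult_ac)
qed

lemma expo_eval_single: "expo_eval (Poly_Mapping.single i 1) x = x $ i"
proof -
  have "expo_eval (Poly_Mapping.single i 1) x = (\<Prod>j\<in>UNIV. if i = j then x $ j else 1)"
    unfolding expo_eval_def by (intro prod.cong) (auto simp: lookup_single when_def)
  then show ?thesis by simp
qed

lemma continuous_on_expo_eval [continuous_intros]: "continuous_on S (expo_eval \<alpha>)"
  unfolding expo_eval_def[abs_def] by (intro continuous_intros)

lemma continuous_on_peval [continuous_intros]: "continuous_on S (peval f)"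
  unfolding peval_def[abs_def] by (intro continuous_intros)

lemma abs_expo_eval_le_1:
  assumes "x \<in> cbox (- 1) 1"
  shows "\<bar>expo_eval \<alpha> x\<bar> \<le> 1"
proof -
  have "\<bar>x $ i\<bar> \<le> 1" for i
    using assms by (auto simp: mem_box_cart abs_le_iff minus_le_iff)
  then show ?thesis
    unfolding expo_eval_def abs_prod power_abs
    by (intro prod_le_1) (auto intro: power_le_one)
qed

text \<open>
  Stone--Weierstrass for polynomials represented as finitely supported maps; the coordinate
  monomials separate points.
\<close>

lemma polynomial_approximation:
  fixes w :: "real ^ 'n::finite \<Rightarrow> real"
  assumes "compact S" "continuous_on S w" "0 < e"
  obtains f where "\<And>x. x \<in> S \<Longrightarrow> \<bar>w x - peval f x\<bar> < e"
proof -
  interpret function_ring_on "range peval" S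
  proof
    show "(\<lambda>x. f x + h x) \<in> range peval" "(\<lambda>x. f x * h x) \<in> range peval"
      if fh: "f \<in> range peval" "h \<in> range peval" for f h :: "real ^ 'n \<Rightarrow> real"
    proof -
      obtain f' h' where "f = peval f'" "h = peval h'"
        using fh by auto
      then have "(\<lambda>x. f x + h x) = peval (f' + h')" "(\<lambda>x. f x * h x) = peval (f' * h')"
        by auto
      then show "(\<lambda>x. f x + h x) \<in> range peval" "(\<lambda>x. f x * h x) \<in> range peval"
        by auto
    qed
    show "(\<lambda>_. c) \<in> range peval" for c
      by (rule range_eqI[of _ _ "Poly_Mapping.single 0 c"]) auto
    show "\<exists>f\<in>range peval. f x \<noteq> f y" if xy: "x \<noteq> y" for x y :: "real ^ 'n"
    proof -
      obtain i where "x $ i \<noteq> y $ i"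
        using xy by (auto simp: vec_eq_iff)
      then have "peval (monom (Poly_Mapping.single i 1)) x \<noteq> peval (monom (Poly_Mapping.single i 1)) y"
        by (simp only: peval_single expo_eval_single)
      then show ?thesis by blast
    qed
  qed (use assms in \<open>auto intro: continuous_on_peval\<close>)
  obtain f where "\<forall>x\<in>S. \<bar>w x - peval f x\<bar> < e"
    using Stone_Weierstrass_basic[OF assms(2,3)] by auto
  then show thesis by (intro that) auto
qed

text \<open>
  The square of a polynomial approximating \<open>\<surd>w\<close> works. Semidefiniteness only speaks about
  squares, and this is how it gives information about nonnegative functions.
\<close>

lemma square_approximation:
  fixes w :: "real ^ 'n::finite \<Rightarrow> real"
  assumes "compact S" "continuous_on S w" "\<And>x. x \<in> S \<Longrightarrow> 0 \<le> w x" "0 < e"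
  obtains h where "\<And>x. x \<in> S \<Longrightarrow> \<bar>w x - peval (h * h) x\<bar> \<le> e"
proof -
  have cont: "continuous_on S (\<lambda>x. sqrt (w x))"
    using assms(2) by (intro continuous_intros)
  then have "bounded ((\<lambda>x. sqrt (w x)) ` S)"
    using assms(1) by (intro compact_imp_bounded compact_continuous_image)
  then obtain b where b: "0 < b" "\<And>x. x \<in> S \<Longrightarrow> \<bar>sqrt (w x)\<bar> \<le> b"
    by (auto simp: bounded_pos)
  \<comment> \<open>From \<open>\<bar>s\<^sup>2 - h\<^sup>2\<bar> = \<bar>s - h\<bar> \<bar>s + h\<bar> \<le> c (2 b + c)\<close> with \<open>s = \<surd>w\<close> and \<open>c \<le> 1\<close>.\<close>
  define c where "c = min 1 (e / (2 * b + 1))"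
  have c: "0 < c" "c \<le> 1" "c * (2 * b + 1) \<le> e"
    using assms(4) b(1) by (auto simp: c_def simp flip: pos_le_divide_eq)
  obtain h where h: "\<And>x. x \<in> S \<Longrightarrow> \<bar>sqrt (w x) - peval h x\<bar> < c"
    using polynomial_approximation[OF assms(1) cont c(1)] by blast
  have "\<bar>w x - peval (h * h) x\<bar> \<le> e" if "x \<in> S" for x
  proof -
    let ?s = "sqrt (w x)"
    have "w x = ?s * ?s" using assms(3)[OF that] by simp
    then have "w x - peval (h * h) x = (?s - peval h x) * (?s + peval h x)"
      by (simp add: algebra_simps)
    then have "\<bar>w x - peval (h * h) x\<bar> = \<bar>?s - peval h x\<bar> * \<bar>?s + peval h x\<bar>"
      by (simp add: abs_mult)
    also have "\<dots> \<le> c * (2 * b + 1)"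
      using h[OF that] b(2)[OF that] c by (intro mult_mono) auto
    finally show ?thesis using c by simp
  qed
  then show thesis using that by blast
qed

lemma expo_deg_add: "expo_deg (\<alpha> + \<beta>) = expo_deg \<alpha> + expo_deg \<beta>"
  by (simp add: expo_deg_def lookup_add sum.distrib)

lemma expo_deg_le_total_deg: "\<alpha> \<in> Poly_Mapping.keys f \<Longrightarrow> expo_deg \<alpha> \<le> total_deg f"
  unfolding total_deg_def by (intro Max_ge) auto

lemma total_deg_le_half_deg: "total_deg f \<le> 2 * half_deg f"
  unfolding half_deg_def by linarith

lemma keys_subset_expos_upto:
  fixes f :: "'n::finite mpoly"
  shows "total_deg f \<le> d \<Longrightarrow> Poly_Mapping.keys f \<subseteq> expos_upto d"
  using expo_deg_le_total_deg by (fastforce simp: expos_upto_def)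

lemma eventually_keys_subset_expos_upto:
  fixes f :: "'n::finite mpoly"
  shows
  "\<forall>\<^sub>F d in sequentially. Poly_Mapping.keys f \<subseteq> expos_upto (d - k)"
  using eventually_ge_at_top[of "total_deg f + k"]
  by eventually_elim (rule keys_subset_expos_upto, simp)

text \<open>
  Moving units from \<open>\<gamma>\<close> to \<open>\<beta>\<close> one at a time. With \<open>expo_deg \<alpha> \<le> 2 d\<close> this shows that
  every entry of a truncated sequence occurs in its moment matrix.
\<close>

lemma expo_split:
  fixes \<alpha> :: "'n::finite expo"
  shows "\<exists>\<beta> \<gamma>. \<alpha> = \<beta> + \<gamma> \<and> expo_deg \<beta> \<le> d \<and> expo_deg \<gamma> \<le> expo_deg \<alpha> - d"
proof (induction d)
  case 0
  show ?case by (intro exI[of _ 0] exI[of _ \<alpha>]) (simp add: expo_deg_def)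
next
  case (Suc d)
  then obtain \<beta> \<gamma> where *: "\<alpha> = \<beta> + \<gamma>" "expo_deg \<beta> \<le> d" "expo_deg \<gamma> \<le> expo_deg \<alpha> - d"
    by blast
  show ?case
  proof (cases "expo_deg \<gamma> = 0")
    case True
    with * show ?thesis by (intro exI[of _ \<beta>] exI[of _ \<gamma>]) simp
  next
    case False
    then obtain i where i: "Poly_Mapping.lookup \<gamma> i \<noteq> 0"
      by (auto simp: expo_deg_def)
    let ?e = "Poly_Mapping.single i 1 :: 'n expo"
    have \<gamma>: "\<gamma> = ?e + (\<gamma> - ?e)"
      using i by (intro poly_mapping_eqI) (auto simp: lookup_add lookup_minus lookup_single when_def)
    have e: "expo_deg ?e = 1"
      by (simp add: expo_deg_def lookup_single when_def)
    have deg: "expo_deg \<gamma> = 1 + expo_deg (\<gamma> - ?e)"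
      by (subst \<gamma>) (simp only: expo_deg_add e)
    show ?thesis
    proof (intro exI conjI)
      show "\<alpha> = (\<beta> + ?e) + (\<gamma> - ?e)" using * \<gamma> by (simp add: add.assoc)
      show "expo_deg (\<beta> + ?e) \<le> Suc d" using * e by (simp add: expo_deg_add)
      show "expo_deg (\<gamma> - ?e) \<le> expo_deg \<alpha> - Suc d" using * deg by simp
    qed
  qed
qed

section \<open>Measures on the unit box\<close>

locale unit_box_measure =
  fixes B :: "(real ^ 'n::finite) set"
  assumes B_borel [measurable]: "B \<in> sets borel" and B_subset: "B \<subseteq> cbox (- 1) 1"
begin

abbreviation \<mu> :: "(real ^ 'n) measure" where
  "\<mu> \<equiv> normalized_lebesgue B"

lemma space_mu [simp]: "space \<mu> = B"
  by (simp add: normalized_lebesgue_def space_scale_measure space_restrict_space)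

lemma sets_mu: "sets \<mu> = sets (restrict_space lborel B)"
  by (simp add: normalized_lebesgue_def)

lemma borel_measurable_mu:
  "f \<in> borel_measurable borel \<Longrightarrow> f \<in> borel_measurable \<mu>"
  by (subst measurable_cong_sets[OF sets_mu refl]) (auto intro: measurable_restrict_space1)

lemma emeasure_mu_space: "emeasure \<mu> B \<le> 1"
proof -
  have inner1: "(1 :: real ^ 'n) \<bullet> b = 1" if "b \<in> Basis" for b
    using that by (auto simp: Basis_vec_def inner_axis)
  have "emeasure lborel B \<le> emeasure lborel (cbox (- 1) (1 :: real ^ 'n))"
    using B_subset by (intro emeasure_mono) auto
  also have "\<dots> = ennreal (\<Prod>b\<in>(Basis :: (real ^ 'n) set). (1 - - 1) \<bullet> b)"
    by (intro emeasure_lborel_cbox) (simp add: inner1)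
  also have "(\<Prod>b\<in>(Basis :: (real ^ 'n) set). (1 - - 1) \<bullet> b) = (\<Prod>b\<in>(Basis :: (real ^ 'n) set). 2)"
    by (intro prod.cong refl) (simp only: inner_diff_left inner_minus_left inner1)
  also have "\<dots> = 2 ^ CARD('n)"
    by simp
  finally have le: "emeasure lborel B \<le> ennreal (2 ^ CARD('n))" .
  have "emeasure \<mu> B = ennreal (1 / 2 ^ CARD('n)) * emeasure lborel B"
    by (simp add: normalized_lebesgue_def emeasure_restrict_space)
  also have "\<dots> \<le> ennreal (1 / 2 ^ CARD('n)) * ennreal (2 ^ CARD('n))"
    by (intro mult_left_mono le) simp
  also have "\<dots> = ennreal (1 / 2 ^ CARD('n) * 2 ^ CARD('n))"
    by (rule ennreal_mult[symmetric]) simp_all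
  also have "\<dots> = 1"
    by simp
  finally show ?thesis .
qed

sublocale finite_measure \<mu>
  using emeasure_mu_space by (intro finite_measureI) (auto simp: top_unique)

lemma measure_mu_space: "measure \<mu> B \<le> 1"
  using emeasure_mu_space by (simp add: emeasure_eq_measure)

lemma integrable_bounded:
  assumes "f \<in> borel_measurable borel" "\<And>x. x \<in> B \<Longrightarrow> \<bar>f x\<bar> \<le> c"
  shows "integrable \<mu> (f :: _ \<Rightarrow> real)"
  using assms by (intro integrable_const_bound[of _ c] borel_measurable_mu AE_I2) auto

lemma continuous_bounded_on_box:
  assumes "continuous_on UNIV (f :: real ^ 'n \<Rightarrow> real)"
  obtains c where "0 < c" "\<And>x. x \<in> cbox (- 1) 1 \<Longrightarrow> \<bar>f x\<bar> \<le> c"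
proof -
  have "bounded (f ` cbox (- 1) 1)"
    by (intro compact_imp_bounded compact_continuous_image continuous_on_subset[OF assms]) auto
  then show thesis
    using that by (auto simp: bounded_pos)
qed

lemma integrable_continuous:
  assumes "continuous_on UNIV (f :: real ^ 'n \<Rightarrow> real)"
  shows "integrable \<mu> f"
proof -
  obtain c where "\<And>x. x \<in> cbox (- 1) 1 \<Longrightarrow> \<bar>f x\<bar> \<le> c"
    using continuous_bounded_on_box[OF assms] by blast
  then show ?thesis
    using assms B_subset by (intro integrable_bounded borel_measurable_continuous_onI) auto
qed

text \<open>
  The normalization makes the total mass at most 1, so uniform bounds pass to integrals
  with no loss in the constant.
\<close>

lemma integral_le_bound:
  fixes c :: real
  assumes "\<And>x. x \<in> B \<Longrightarrow> f x \<le> c" "0 \<le> c" "integrable \<mu> f"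
  shows "(\<integral>x. f x \<partial>\<mu>) \<le> c"
proof -
  have "(\<integral>x. f x \<partial>\<mu>) \<le> (\<integral>x. c \<partial>\<mu>)"
    using assms by (intro Bochner_Integration.integral_mono) auto
  also have "\<dots> \<le> c"
    using mult_right_mono[OF measure_mu_space assms(2)] by simp
  finally show ?thesis .
qed

text \<open>
  Moments of the measure with density \<open>w\<close>. The weights that occur are the constant 1, the
  indicator of \<open>K\<close>, its complement, and the indicator multiplied by a constraint \<open>g j\<close>; the
  matrices of the relaxation at the moments of \<open>\<mu>\<close> restricted to \<open>K\<close> all have this form.
\<close>

definition weighted_moments :: "(real ^ 'n \<Rightarrow> real) \<Rightarrow> 'n expo \<Rightarrow> real" where
  "weighted_moments w \<alpha> = (\<integral>x. w x * expo_eval \<alpha> x \<partial>\<mu>)"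

lemma integrable_weighted:
  assumes "w \<in> borel_measurable borel" "\<And>x. x \<in> B \<Longrightarrow> \<bar>w x\<bar> \<le> c" "continuous_on UNIV f"
  shows "integrable \<mu> (\<lambda>x. w x * f x :: real)"
proof -
  obtain b where b: "0 < b" "\<And>x. x \<in> cbox (- 1) 1 \<Longrightarrow> \<bar>f x\<bar> \<le> b"
    using continuous_bounded_on_box[OF assms(3)] by blast
  show ?thesis
  proof (rule integrable_bounded)
    show "(\<lambda>x. w x * f x) \<in> borel_measurable borel"
      using assms(1) borel_measurable_continuous_onI[OF assms(3)] by simp
    show "\<bar>w x * f x\<bar> \<le> c * b" if "x \<in> B" for x
    proof -
      have "\<bar>w x\<bar> \<le> c" "\<bar>f x\<bar> \<le> b"
        using assms(2) b(2) B_subset that by auto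
      then show ?thesis
        unfolding abs_mult by (intro mult_mono) auto
    qed
  qed
qed

lemma riesz_weighted_moments:
  assumes "w \<in> borel_measurable borel" "\<And>x. x \<in> B \<Longrightarrow> \<bar>w x\<bar> \<le> c"
  shows "riesz (weighted_moments w) f = (\<integral>x. w x * peval f x \<partial>\<mu>)"
proof -
  have "(\<integral>x. w x * peval f x \<partial>\<mu>) =
      (\<integral>x. (\<Sum>\<alpha>\<in>Poly_Mapping.keys f. Poly_Mapping.lookup f \<alpha> * (w x * expo_eval \<alpha> x)) \<partial>\<mu>)"
    by (simp add: peval_def sum_distrib_left mult.left_commute)
  also have "\<dots> = (\<Sum>\<alpha>\<in>Poly_Mapping.keys f.
      (\<integral>x. Poly_Mapping.lookup f \<alpha> * (w x * expo_eval \<alpha> x) \<partial>\<mu>))"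
    using assms
    by (intro Bochner_Integration.integral_sum integrable_mult_right integrable_weighted[of _ c]
        continuous_intros) auto
  also have "\<dots> = riesz (weighted_moments w) f"
    by (simp add: riesz_def weighted_moments_def)
  finally show ?thesis ..
qed

lemma moments_eq_weighted: "moments \<mu> = weighted_moments (\<lambda>_. 1)"
  by (simp add: fun_eq_iff moments_def weighted_moments_def)

lemma riesz_moments: "riesz (moments \<mu>) f = (\<integral>x. peval f x \<partial>\<mu>)"
  unfolding moments_eq_weighted by (subst riesz_weighted_moments[of _ 1]) auto

lemma psd_on_weighted_moments:
  assumes "finite I" "w \<in> borel_measurable borel" "\<And>x. x \<in> B \<Longrightarrow> 0 \<le> w x \<and> w x \<le> c"
  shows "psd_on I (\<lambda>\<alpha> \<beta>. weighted_moments w (\<alpha> + \<beta>))"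
  unfolding psd_on_def
proof (intro conjI ballI allI)
  show "weighted_moments w (\<alpha> + \<beta>) = weighted_moments w (\<beta> + \<alpha>)" for \<alpha> \<beta>
    by (simp add: add.commute)
  fix v :: "'n expo \<Rightarrow> real"
  have int: "integrable \<mu> (\<lambda>x. w x * expo_eval \<alpha> x)" for \<alpha>
    using assms by (intro integrable_weighted[of _ c] continuous_intros) auto
  have "0 \<le> (\<integral>x. w x * (\<Sum>\<alpha>\<in>I. v \<alpha> * expo_eval \<alpha> x)\<^sup>2 \<partial>\<mu>)"
    using assms by (intro Bochner_Integration.integral_nonneg) auto
  also have "\<dots> = (\<integral>x. (\<Sum>\<alpha>\<in>I. \<Sum>\<beta>\<in>I. v \<alpha> * v \<beta> * (w x * expo_eval (\<alpha> + \<beta>) x)) \<partial>\<mu>)"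
    by (intro Bochner_Integration.integral_cong refl)
       (simp add: power2_eq_square sum_product sum_distrib_left expo_eval_add mult_ac)
  also have "\<dots> = (\<Sum>\<alpha>\<in>I. \<Sum>\<beta>\<in>I. v \<alpha> * v \<beta> * weighted_moments w (\<alpha> + \<beta>))"
    by (simp add: Bochner_Integration.integral_sum int weighted_moments_def)
  also have "\<dots> = (\<Sum>\<alpha>\<in>I. \<Sum>\<beta>\<in>I. v \<alpha> * weighted_moments w (\<alpha> + \<beta>) * v \<beta>)"
    by (simp add: mult_ac)
  finally show "0 \<le> (\<Sum>\<alpha>\<in>I. \<Sum>\<beta>\<in>I. v \<alpha> * weighted_moments w (\<alpha> + \<beta>) * v \<beta>)" .
qed

section \<open>Asymptotic positivity of dominated moment sequences\<close>

text \<open>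
  The part of the constraints that does not mention \<open>g\<close>. It says that, on squares of degree
  at most \<open>2 d\<close>, the functional of \<open>y\<close> lies between 0 and integration against \<open>\<mu>\<close>. It is
  invariant under \<open>y \<mapsto> moments \<mu> - y\<close>, so each lower bound yields an upper bound.
\<close>

definition dominated :: "nat \<Rightarrow> ('n expo \<Rightarrow> real) \<Rightarrow> bool" where
  "dominated d y \<longleftrightarrow>
     psd_on (expos_upto d) (moment_matrix y) \<and>
     psd_on (expos_upto d) (moment_matrix (\<lambda>\<alpha>. moments \<mu> \<alpha> - y \<alpha>))"

lemma dominated_complement:
  "dominated d y \<Longrightarrow> dominated d (\<lambda>\<alpha>. moments \<mu> \<alpha> - y \<alpha>)"
  by (simp add: dominated_def)

lemma dominated_square:
  assumes "dominated d y" "Poly_Mapping.keys h \<subseteq> expos_upto d"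
  shows "0 \<le> riesz y (h * h)" "riesz y (h * h) \<le> (\<integral>x. (peval h x)\<^sup>2 \<partial>\<mu>)"
  using assms riesz_square_nonneg[of d y h]
    riesz_square_nonneg[of d "\<lambda>\<alpha>. moments \<mu> \<alpha> - y \<alpha>" h]
  by (simp_all add: dominated_def riesz_diff_sequence riesz_moments power2_eq_square)

lemma dominated_mass:
  assumes "dominated d y"
  shows "y 0 \<le> 1"
proof -
  have "y 0 \<le> (\<integral>x. (peval 1 x)\<^sup>2 \<partial>\<mu>)"
    using dominated_square(2)[OF assms, of 1] by (simp add: expos_upto_def expo_deg_def)
  also have "\<dots> \<le> 1"
    using measure_mu_space by simp
  finally show ?thesis .
qed

text \<open>
  A polynomial that is uniformly small on \<open>B\<close> has a functional value that is not very
  negative: expand \<open>0 \<le> L((u + e)\<^sup>2) = L(u\<^sup>2) + 2 e L(u) + e\<^sup>2 L(1)\<close> and use that \<open>L(u\<^sup>2)\<close> and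
  \<open>e\<^sup>2 L(1)\<close> are at most \<open>e\<^sup>2\<close>. The bound on \<open>L(u\<^sup>2)\<close> is where the domination by \<open>\<mu>\<close> enters;
  positivity on squares alone would not control \<open>L\<close> by uniform norms on the box.
\<close>

lemma dominated_small:
  assumes "dominated d y" "0 < e" "\<And>x. x \<in> B \<Longrightarrow> \<bar>peval u x\<bar> \<le> e"
    and "Poly_Mapping.keys u \<subseteq> expos_upto d"
  shows "- e \<le> riesz y u"
proof -
  let ?c = "Poly_Mapping.single 0 e :: 'n mpoly"
  have "Poly_Mapping.keys (u + ?c) \<subseteq> expos_upto d"
    using keys_add[of u ?c] assms(4) by (auto simp: expos_upto_def expo_deg_def split: if_splits)
  from dominated_square(1)[OF assms(1) this]
  have "0 \<le> riesz y ((u + ?c) * (u + ?c))" .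
  also have "(u + ?c) * (u + ?c) = u * u + (?c * u + ?c * u) + ?c * ?c"
    by (simp add: algebra_simps)
  also have "riesz y \<dots> = riesz y (u * u) + 2 * e * riesz y u + e\<^sup>2 * y 0"
    by (simp only: riesz_add riesz_scale mult_single riesz_single add_0_left)
       (simp add: power2_eq_square)
  also have "riesz y (u * u) \<le> e\<^sup>2"
  proof -
    have "riesz y (u * u) \<le> (\<integral>x. (peval u x)\<^sup>2 \<partial>\<mu>)"
      using dominated_square(2)[OF assms(1,4)] .
    also have "\<dots> \<le> e\<^sup>2"
      using assms(2,3)
      by (intro integral_le_bound integrable_continuous continuous_intros)
         (auto simp: abs_le_square_iff[symmetric])
    finally show ?thesis .
  qed
  also have "e\<^sup>2 * y 0 \<le> e\<^sup>2 * 1"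
    using dominated_mass[OF assms(1)] by (intro mult_left_mono) auto
  finally have "0 \<le> 2 * e * (e + riesz y u)"
    by (simp add: power2_eq_square algebra_simps)
  then show ?thesis
    using assms(2) by (simp add: zero_le_mult_iff)
qed

text \<open>
  Replace \<open>f\<close> by a square \<open>h\<^sup>2\<close> that is uniformly close to it on the box: \<open>L(h\<^sup>2) \<ge> 0\<close>, and
  the error is handled by the preceding estimate. Since \<open>h\<close> depends only on \<open>f\<close> and \<open>e\<close>, the
  bound holds at all large orders for all dominated sequences simultaneously.
\<close>

lemma eventually_dominated_nonneg:
  fixes f :: "'n mpoly"
  assumes "\<And>x. x \<in> cbox (- 1) 1 \<Longrightarrow> 0 \<le> peval f x" "0 < e"
  shows "\<forall>\<^sub>F d in sequentially. \<forall>y. dominated d y \<longrightarrow> - e \<le> riesz y f"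
proof -
  obtain h where h: "\<And>x. x \<in> cbox (- 1) 1 \<Longrightarrow> \<bar>peval f x - peval (h * h) x\<bar> \<le> e"
    using square_approximation[of "cbox (- 1) 1" "peval f" e] assms
    by (auto intro: continuous_on_peval)
  have "\<forall>\<^sub>F d in sequentially. Poly_Mapping.keys h \<subseteq> expos_upto d"
       "\<forall>\<^sub>F d in sequentially. Poly_Mapping.keys (f - h * h) \<subseteq> expos_upto d"
    using eventually_keys_subset_expos_upto[where k = 0] by simp_all
  then show ?thesis
  proof eventually_elim
    case (elim d)
    show ?case
    proof (intro allI impI)
      fix y assume y: "dominated d y"
      have "- e \<le> riesz y (f - h * h)"
        using h B_subset by (intro dominated_small[OF y assms(2) _ elim(2)]) auto
      moreover have "0 \<le> riesz y (h * h)"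
        using dominated_square(1)[OF y elim(1)] .
      ultimately show "- e \<le> riesz y f"
        by (simp add: riesz_diff)
    qed
  qed
qed

lemma eventually_dominated_le_integral:
  fixes f :: "'n mpoly"
  assumes "\<And>x. x \<in> cbox (- 1) 1 \<Longrightarrow> 0 \<le> peval f x" "0 < e"
  shows "\<forall>\<^sub>F d in sequentially. \<forall>y. dominated d y \<longrightarrow> riesz y f \<le> (\<integral>x. peval f x \<partial>\<mu>) + e"
proof -
  have "\<forall>\<^sub>F d in sequentially. \<forall>y. dominated d y \<longrightarrow> - e \<le> riesz y f"
    by (rule eventually_dominated_nonneg) (use assms in auto)
  then show ?thesis
  proof eventually_elim
    case (elim d)
    then show ?case
      using dominated_complement by (fastforce simp: riesz_diff_sequence riesz_moments)
  qed
qed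

end

section \<open>The relaxations\<close>

lemma closed_psd_on:
  assumes "\<And>i j. i \<in> I \<Longrightarrow> j \<in> I \<Longrightarrow> continuous_on UNIV (\<lambda>y. A y i j)"
  shows "closed {y. psd_on I (A y)}"
proof -
  have "{y. psd_on I (A y)} =
      (\<Inter>i\<in>I. \<Inter>j\<in>I. {y. A y i j = A y j i}) \<inter>
      (\<Inter>v. {y. 0 \<le> (\<Sum>i\<in>I. \<Sum>j\<in>I. v i * A y i j * v j)})"
    by (auto simp: psd_on_def)
  also have "closed \<dots>"
    using assms
    by (intro closed_Int closed_INT ballI closed_Collect_eq closed_Collect_le continuous_intros) auto
  finally show ?thesis .
qed

lemma continuous_on_riesz: "continuous_on UNIV (\<lambda>y. riesz y f)"
  unfolding riesz_def by (intro continuous_intros continuous_on_product_coordinates)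

lemma riesz_restrict:
  "Poly_Mapping.keys f \<subseteq> I \<Longrightarrow> riesz (restrict y I) f = riesz y f"
  unfolding riesz_def by (intro sum.cong) auto

lemma add_in_expos_upto:
  "\<alpha> \<in> expos_upto d \<Longrightarrow> \<beta> \<in> expos_upto d \<Longrightarrow> \<alpha> + \<beta> \<in> expos_upto (2 * d)"
  by (simp add: expos_upto_def expo_deg_add)

lemma keys_mult_monom_subset:
  fixes q :: "'n::finite mpoly"
  assumes "half_deg q \<le> d" "\<alpha> \<in> expos_upto (d - half_deg q)" "\<beta> \<in> expos_upto (d - half_deg q)"
  shows "Poly_Mapping.keys (q * monom (\<alpha> + \<beta>)) \<subseteq> expos_upto (2 * d)"
proof
  fix \<gamma> assume "\<gamma> \<in> Poly_Mapping.keys (q * monom (\<alpha> + \<beta>))"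
  then obtain \<delta> where "\<gamma> = \<delta> + (\<alpha> + \<beta>)" "\<delta> \<in> Poly_Mapping.keys q"
    using keys_mult[of q "monom (\<alpha> + \<beta>)"] by auto
  then show "\<gamma> \<in> expos_upto (2 * d)"
    using expo_deg_le_total_deg[of \<delta> q] total_deg_le_half_deg[of q] assms
    by (simp add: expos_upto_def expo_deg_add)
qed

text \<open>
  The diagonal entries \<open>y (2 \<beta>)\<close> lie in the unit interval because \<open>\<bar>x\<^sup>\<beta>\<bar> \<le> 1\<close> on the box;
  the squares \<open>(x\<^sup>\<beta> \<plusminus> x\<^sup>\<gamma>)\<^sup>2\<close> then bound the remaining entries.
\<close>

lemma (in unit_box_measure) abs_dominated_le_1:
  assumes y: "dominated d y" and \<alpha>: "\<alpha> \<in> expos_upto (2 * d)"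
  shows "\<bar>y \<alpha>\<bar> \<le> 1"
proof -
  have diag: "y (\<beta> + \<beta>) \<le> 1" if "\<beta> \<in> expos_upto d" for \<beta>
  proof -
    have "y (\<beta> + \<beta>) \<le> (\<integral>x. (expo_eval \<beta> x)\<^sup>2 \<partial>\<mu>)"
      using dominated_square(2)[OF y, of "monom \<beta>"] that by (simp add: mult_single)
    also have "\<dots> \<le> 1"
      using B_subset abs_expo_eval_le_1
      by (intro integral_le_bound integrable_continuous continuous_intros)
         (auto simp: abs_square_le_1)
    finally show ?thesis .
  qed
  obtain \<beta> \<gamma> where \<beta>\<gamma>: "\<alpha> = \<beta> + \<gamma>" "\<beta> \<in> expos_upto d" "\<gamma> \<in> expos_upto d"
    using expo_split[of \<alpha> d] \<alpha> by (auto simp: expos_upto_def)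
  note expand = distrib_left distrib_right left_diff_distrib right_diff_distrib riesz_add riesz_diff
    mult_single riesz_single add.commute[of \<gamma> \<beta>]
  have "0 \<le> riesz y ((monom \<beta> + monom \<gamma>) * (monom \<beta> + monom \<gamma>))"
    using \<beta>\<gamma> keys_add[of "monom \<beta>" "monom \<gamma> :: 'n mpoly"]
    by (intro dominated_square(1)[OF y]) auto
  moreover have "0 \<le> riesz y ((monom \<beta> - monom \<gamma>) * (monom \<beta> - monom \<gamma>))"
    using \<beta>\<gamma> keys_diff[of "monom \<beta>" "monom \<gamma> :: 'n mpoly"]
    by (intro dominated_square(1)[OF y]) auto
  ultimately have "\<bar>y (\<beta> + \<gamma>)\<bar> \<le> (y (\<beta> + \<beta>) + y (\<gamma> + \<gamma>)) / 2"
    by (simp only: expand) (simp add: abs_le_iff)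
  then show ?thesis
    using diag[OF \<beta>\<gamma>(2)] diag[OF \<beta>\<gamma>(3)] \<beta>\<gamma>(1) by simp
qed

locale moment_relaxation = unit_box_measure B
  for B :: "(real ^ 'n::finite) set" +
  fixes g :: "nat \<Rightarrow> 'n mpoly" and m :: nat
  assumes K_subset: "semialg g m \<subseteq> B"
begin

abbreviation K :: "(real ^ 'n) set" where
  "K \<equiv> semialg g m"

definition constraints :: "nat \<Rightarrow> ('n expo \<Rightarrow> real) \<Rightarrow> bool" where
  "constraints d y \<longleftrightarrow> dominated d y \<and>
     (\<forall>j\<in>{1..m}. psd_on (expos_upto (d - half_deg (g j))) (localizing_matrix (g j) y))"

lemma feasible_iff:
  "feasible g m B d y \<longleftrightarrow> y \<in> extensional (expos_upto (2 * d)) \<and> constraints d y"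
  by (auto simp: feasible_def constraints_def dominated_def)

text \<open>
  All matrices at order \<open>d\<close> are principal submatrices of those at order \<open>d' \<ge> d\<close> and involve
  only entries of degree at most \<open>2 d\<close>. The localizing matrices satisfy this
  degree bound because \<open>half_deg (g j) \<le> d\<close>; otherwise the natural subtraction would truncate.
\<close>

lemma feasible_restrict:
  assumes y: "constraints d' y" and d: "d \<le> d'" "\<And>j. j \<in> {1..m} \<Longrightarrow> half_deg (g j) \<le> d"
  shows "feasible g m B d (restrict y (expos_upto (2 * d)))"
proof -
  have sub: "expos_upto (d - k) \<subseteq> (expos_upto (d' - k) :: 'n expo set)" for k
    using d(1) by (auto simp: expos_upto_def)
  have "psd_on (expos_upto d') (moment_matrix y)"
    "psd_on (expos_upto d') (moment_matrix (\<lambda>\<alpha>. moments \<mu> \<alpha> - y \<alpha>))"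
    using y by (auto simp: constraints_def dominated_def)
  note psd = this[THEN psd_on_subset, OF finite_expos_upto]
  have "psd_on (expos_upto d) (moment_matrix (restrict y (expos_upto (2 * d))))"
    by (rule psd(1)) (use sub[of 0] in \<open>auto simp: moment_matrix_def add_in_expos_upto\<close>)
  moreover have "psd_on (expos_upto d)
      (moment_matrix (\<lambda>\<alpha>. moments \<mu> \<alpha> - restrict y (expos_upto (2 * d)) \<alpha>))"
    by (rule psd(2)) (use sub[of 0] in \<open>auto simp: moment_matrix_def add_in_expos_upto\<close>)
  moreover have "psd_on (expos_upto (d - half_deg (g j)))
      (localizing_matrix (g j) (restrict y (expos_upto (2 * d))))" if j: "j \<in> {1..m}" for j
  proof (rule psd_on_subset[OF _ finite_expos_upto sub])
    show "psd_on (expos_upto (d' - half_deg (g j))) (localizing_matrix (g j) y)"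
      using y j by (simp add: constraints_def)
  qed (simp add: localizing_matrix_def riesz_restrict keys_mult_monom_subset d(2)[OF j])
  moreover have "restrict y (expos_upto (2 * d)) \<in> extensional (expos_upto (2 * d))"
    by simp
  ultimately show ?thesis
    by (simp add: feasible_def)
qed

text \<open>
  The feasible set is closed in the product topology and lies in a product of compact
  intervals (degree at most \<open>2 d\<close>) and points (all other exponents), so Tychonoff applies.
\<close>

lemma compact_feasible: "compact {y. feasible g m B d y}"
proof -
  let ?I = "expos_upto (2 * d) :: 'n expo set"
  let ?S = "\<lambda>\<alpha>. if \<alpha> \<in> ?I then {- 1..1} else {undefined :: real}"
  have "compactin (product_topology (\<lambda>_. euclidean) UNIV) (PiE UNIV ?S)"
    by (subst compactin_PiE) auto
  then have compact: "compact (PiE UNIV ?S)"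
    by (simp add: euclidean_product_topology)
  have "closed ({y. psd_on (expos_upto d) (moment_matrix y)} \<inter>
      {y. psd_on (expos_upto d) (moment_matrix (\<lambda>\<alpha>. moments \<mu> \<alpha> - y \<alpha>))} \<inter>
      (\<Inter>j\<in>{1..m}. {y. psd_on (expos_upto (d - half_deg (g j))) (localizing_matrix (g j) y)}))"
    unfolding moment_matrix_def localizing_matrix_def
    by (intro closed_Int closed_INT ballI closed_psd_on continuous_intros continuous_on_riesz
        continuous_on_product_coordinates)
  also have "\<dots> = {y. constraints d y}"
    by (auto simp: constraints_def dominated_def)
  finally have closed: "closed {y. constraints d y}" .
  have "{y. feasible g m B d y} = {y. constraints d y} \<inter> PiE UNIV ?S"
    using abs_dominated_le_1
    by (auto simp: feasible_iff constraints_def PiE_iff extensional_def abs_le_iff split: if_splits)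
  then show ?thesis
    using closed_Int_compact[OF closed compact] by simp
qed

lemma K_borel [measurable]: "K \<in> sets borel"
proof -
  have "K = (\<Inter>j\<in>{1..m}. {x. 0 \<le> peval (g j) x})"
    by (auto simp: semialg_def)
  also have "closed \<dots>"
    by (intro closed_INT ballI closed_Collect_le continuous_intros)
  finally show ?thesis by (rule borel_closed)
qed

lemma set_integral_K: "(LINT x:K|\<mu>. f x) = (\<integral>x. indicator K x * f x \<partial>\<mu>)"
  for f :: "real ^ 'n \<Rightarrow> real"
  by (simp add: set_lebesgue_integral_def)

lemma integrable_K:
  assumes "continuous_on UNIV f"
  shows "integrable \<mu> (\<lambda>x. indicator K x * f x :: real)"
  using assms by (intro integrable_weighted[of _ 1]) (auto simp: indicator_def)

text \<open>
  The moments of \<open>\<mu>\<close> restricted to \<open>K\<close> satisfy the constraints at every order. This is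
  the source of the lower bound on the optimal values.
\<close>

lemma constraints_K_moments: "constraints d (weighted_moments (indicator K))"
proof -
  have "moments \<mu> \<alpha> - weighted_moments (indicator K) \<alpha> =
      weighted_moments (\<lambda>x. 1 - indicator K x) \<alpha>" for \<alpha>
    using Bochner_Integration.integral_diff[OF
        integrable_continuous[OF continuous_on_expo_eval[of UNIV \<alpha>]]
        integrable_K[OF continuous_on_expo_eval[of UNIV \<alpha>]]]
    by (simp add: moments_def weighted_moments_def left_diff_distrib)
  then have "psd_on (expos_upto d)
      (moment_matrix (\<lambda>\<alpha>. moments \<mu> \<alpha> - weighted_moments (indicator K) \<alpha>))"
    unfolding moment_matrix_def
    by (auto intro!: psd_on_weighted_moments[of _ _ 1] finite_expos_upto simp: indicator_def[of K])
  moreover have "psd_on (expos_upto d) (moment_matrix (weighted_moments (indicator K)))"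
    unfolding moment_matrix_def
    by (intro psd_on_weighted_moments[of _ _ 1] finite_expos_upto) (auto simp: indicator_def)
  moreover have "psd_on (expos_upto (d - half_deg (g j)))
      (localizing_matrix (g j) (weighted_moments (indicator K)))" if j: "j \<in> {1..m}" for j
  proof -
    obtain c where c: "0 < c" "\<And>x. x \<in> cbox (- 1) 1 \<Longrightarrow> \<bar>peval (g j) x\<bar> \<le> c"
      using continuous_bounded_on_box[OF continuous_on_peval] by blast
    have "localizing_matrix (g j) (weighted_moments (indicator K)) =
        (\<lambda>\<alpha> \<beta>. weighted_moments (\<lambda>x. indicator K x * peval (g j) x) (\<alpha> + \<beta>))"
      unfolding localizing_matrix_def
      by (subst riesz_weighted_moments[of _ 1])
         (auto simp: indicator_def[of K] weighted_moments_def mult.assoc)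
    moreover have "psd_on (expos_upto (d - half_deg (g j)))
        (\<lambda>\<alpha> \<beta>. weighted_moments (\<lambda>x. indicator K x * peval (g j) x) (\<alpha> + \<beta>))"
    proof (rule psd_on_weighted_moments[of _ _ c])
      show "(\<lambda>x. indicator K x * peval (g j) x) \<in> borel_measurable borel"
        by (intro borel_measurable_times borel_measurable_indicator K_borel
            borel_measurable_continuous_onI continuous_on_peval)
      show "0 \<le> indicator K x * peval (g j) x \<and> indicator K x * peval (g j) x \<le> c"
        if "x \<in> B" for x
        using c B_subset that j by (fastforce simp: indicator_def semialg_def abs_le_iff)
    qed (rule finite_expos_upto)
    ultimately show ?thesis by simp
  qed
  ultimately show ?thesis
    by (simp add: constraints_def dominated_def)
qed

lemma riesz_K_moments:
  "riesz (weighted_moments (indicator K)) f = (LINT x:K|\<mu>. peval f x)"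
  unfolding set_integral_K by (rule riesz_weighted_moments[of _ 1]) (auto simp: indicator_def)

section \<open>The upper bound\<close>

text \<open>
  A continuous nonnegative function whose zero set is \<open>K\<close>. The square makes \<open>N * penalty\<close>
  equal to \<open>- \<Sum>j. w j * g j\<close> with the continuous weights
  \<open>w j = N * max 0 (- g j) \<ge> 0\<close>, which can be approximated by squares of polynomials.
\<close>

definition penalty :: "real ^ 'n \<Rightarrow> real" where
  "penalty x = (\<Sum>j=1..m. (max 0 (- peval (g j) x))\<^sup>2)"

lemma continuous_on_penalty [continuous_intros]: "continuous_on S penalty"
  unfolding penalty_def[abs_def] by (intro continuous_intros)

lemma penalty_nonneg: "0 \<le> penalty x"
  unfolding penalty_def by (intro sum_nonneg) auto

lemma penalty_eq_0_iff: "penalty x = 0 \<longleftrightarrow> x \<in> K"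
  unfolding penalty_def semialg_def
  by (subst sum_nonneg_eq_0_iff) (auto simp: max_def split: if_splits)

lemma penalised_integral_tendsto:
  fixes f :: "real ^ 'n \<Rightarrow> real"
  assumes f: "continuous_on UNIV f"
  shows "(\<lambda>N. \<integral>x. max 0 (f x - real N * penalty x) \<partial>\<mu>) \<longlonglongrightarrow> (LINT x:K|\<mu>. max 0 (f x))"
  unfolding set_integral_K
proof (rule integral_dominated_convergence)
  show "integrable \<mu> (\<lambda>x. \<bar>f x\<bar>)"
    by (intro integrable_continuous continuous_intros f)
  show "(\<lambda>x. indicator K x * max 0 (f x)) \<in> borel_measurable \<mu>"
    by (intro borel_measurable_integrable integrable_K continuous_intros f)
  show "(\<lambda>x. max 0 (f x - real N * penalty x)) \<in> borel_measurable \<mu>" for N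
    by (intro borel_measurable_integrable integrable_continuous continuous_intros f)
  show "AE x in \<mu>. norm (max 0 (f x - real N * penalty x)) \<le> \<bar>f x\<bar>" for N
  proof (rule AE_I2)
    fix x
    have "0 \<le> real N * penalty x"
      using penalty_nonneg by simp
    then show "norm (max 0 (f x - real N * penalty x)) \<le> \<bar>f x\<bar>"
      by auto
  qed
  show "AE x in \<mu>. (\<lambda>N. max 0 (f x - real N * penalty x)) \<longlonglongrightarrow> indicator K x * max 0 (f x)"
  proof (rule AE_I2)
    fix x
    show "(\<lambda>N. max 0 (f x - real N * penalty x)) \<longlonglongrightarrow> indicator K x * max 0 (f x)"
    proof (cases "x \<in> K")
      case True
      then show ?thesis using penalty_eq_0_iff[of x] by simp
    next
      case False
      then have pos: "0 < penalty x"
        using penalty_eq_0_iff[of x] penalty_nonneg[of x] by simp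
      have "\<forall>\<^sub>F N in sequentially. f x / penalty x \<le> real N"
        using eventually_ge_at_top[of "nat \<lceil>f x / penalty x\<rceil>"]
        by eventually_elim linarith
      then have "\<forall>\<^sub>F N in sequentially. max 0 (f x - real N * penalty x) = 0"
        by eventually_elim (use pos in \<open>simp add: field_simps\<close>)
      then show ?thesis using False by (simp add: tendsto_eventually)
    qed
  qed
qed

text \<open>
  With \<open>G\<close> the penalty, \<open>f \<le> max 0 (f - N G) + N G\<close> holds everywhere. For \<open>N\<close> large the
  integral of the first summand is close to that of the positive part of \<open>f\<close> over \<open>K\<close>, and the
  functional is at most this integral on nonnegative functions; the second summand is
  \<open>- \<Sum>j. w j * g j\<close> with nonnegative weights, on which the localizing constraints make the
  functional nonpositive. Polynomials \<open>s\<close> and \<open>v j\<close> with \<open>s\<close> close to \<open>max 0 (f - N G)\<close> and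
  \<open>(v j)\<^sup>2\<close> close to \<open>w j\<close> turn this into a statement about the functional. They depend only
  on \<open>f\<close> and \<open>e\<close>, whence the uniformity in \<open>y\<close>.
\<close>

lemma eventually_le_positive_part:
  fixes f :: "'n mpoly"
  assumes e: "0 < e"
  shows "\<forall>\<^sub>F d in sequentially. \<forall>y. constraints d y \<longrightarrow>
    riesz y f \<le> (LINT x:K|\<mu>. max 0 (peval f x)) + e"
proof -
  \<comment> \<open>One sixth: one \<open>\<delta>\<close> for the choice of \<open>N\<close>, two for \<open>s\<close>, two for the lower bound on \<open>riesz y t\<close> and the constant in \<open>t\<close>, one for the upper bound on \<open>riesz y s\<close>.\<close>
  define \<delta> where "\<delta> = e / 6"
  have \<delta>: "0 < \<delta>" using e by (simp add: \<delta>_def)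
  let ?P = "LINT x:K|\<mu>. max 0 (peval f x)"
  have "\<forall>\<^sub>F N in sequentially. (\<integral>x. max 0 (peval f x - real N * penalty x) \<partial>\<mu>) < ?P + \<delta>"
    using order_tendstoD(2)[OF penalised_integral_tendsto[OF continuous_on_peval], of f "?P + \<delta>"] \<delta>
    by simp
  then obtain N where N: "(\<integral>x. max 0 (peval f x - real N * penalty x) \<partial>\<mu>) < ?P + \<delta>"
    by (auto simp: eventually_sequentially)
  define c where "c x = max 0 (peval f x - real N * penalty x)" for x
  have c_cont: "continuous_on S c" for S
    unfolding c_def[abs_def] by (intro continuous_intros)
  \<comment> \<open>The shift by \<open>\<delta>\<close> makes the approximation lie above \<open>c\<close>, hence nonnegative.\<close>
  obtain s where s: "\<And>x. x \<in> cbox (- 1) 1 \<Longrightarrow> \<bar>(c x + \<delta>) - peval s x\<bar> < \<delta>"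
    using polynomial_approximation[OF compact_cbox continuous_on_add[OF c_cont continuous_on_const] \<delta>]
    by blast
  have s_bounds: "c x \<le> peval s x" "peval s x \<le> c x + 2 * \<delta>" "0 \<le> peval s x"
    if "x \<in> cbox (- 1) 1" for x
    using s[OF that] by (auto simp: c_def)
  have "\<exists>v. \<forall>x\<in>cbox (- 1) 1.
      \<bar>N * max 0 (- peval (g j) x) * peval (g j) x - peval (g j * (v * v)) x\<bar> \<le> \<delta> / (m + 1)" for j
  proof -
    obtain b where b: "0 < b" "\<And>x. x \<in> cbox (- 1) 1 \<Longrightarrow> \<bar>peval (g j) x\<bar> \<le> b"
      using continuous_bounded_on_box[OF continuous_on_peval] by blast
    have w_cont: "continuous_on (cbox (- 1) 1) (\<lambda>x. N * max 0 (- peval (g j) x))"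
      by (intro continuous_intros)
    obtain v where v: "\<And>x. x \<in> cbox (- 1) 1 \<Longrightarrow>
        \<bar>N * max 0 (- peval (g j) x) - peval (v * v) x\<bar> \<le> \<delta> / (m + 1) / b"
      using square_approximation[OF compact_cbox w_cont, of "\<delta> / (m + 1) / b"] \<delta> b(1) by auto
    have "\<bar>N * max 0 (- peval (g j) x) * peval (g j) x - peval (g j * (v * v)) x\<bar> \<le> \<delta> / (m + 1)"
      if "x \<in> cbox (- 1) 1" for x
    proof -
      have "N * max 0 (- peval (g j) x) * peval (g j) x - peval (g j * (v * v)) x =
          (N * max 0 (- peval (g j) x) - peval (v * v) x) * peval (g j) x"
        by (simp add: algebra_simps)
      also have "\<bar>\<dots>\<bar> \<le> \<delta> / (m + 1) / b * b"
        unfolding abs_mult using v[OF that] b that \<delta> by (intro mult_mono) auto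
      finally show ?thesis using b(1) by simp
    qed
    then show ?thesis by blast
  qed
  then obtain v where v: "\<And>j x. x \<in> cbox (- 1) 1 \<Longrightarrow>
      \<bar>N * max 0 (- peval (g j) x) * peval (g j) x - peval (g j * (v j * v j)) x\<bar> \<le> \<delta> / (m + 1)"
    by metis
  define t where "t = s - (\<Sum>j=1..m. g j * (v j * v j)) - f + Poly_Mapping.single 0 \<delta>"
  have t_nonneg: "0 \<le> peval t x" if x: "x \<in> cbox (- 1) 1" for x
  proof -
    have "(\<Sum>j=1..m. peval (g j * (v j * v j)) x) \<le>
        (\<Sum>j=1..m. \<delta> / (m + 1) - N * (max 0 (- peval (g j) x))\<^sup>2)"
    proof (rule sum_mono)
      fix j
      have "max 0 (- peval (g j) x) * peval (g j) x = - (max 0 (- peval (g j) x))\<^sup>2"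
        by (simp add: max_def power2_eq_square)
      then show "peval (g j * (v j * v j)) x \<le> \<delta> / (m + 1) - N * (max 0 (- peval (g j) x))\<^sup>2"
        using v[OF x, of j] by (simp add: mult.assoc abs_le_iff)
    qed
    also have "\<dots> = m * (\<delta> / (m + 1)) - N * penalty x"
      by (simp add: sum_subtractf sum_distrib_left penalty_def)
    also have "m * (\<delta> / (m + 1)) \<le> \<delta>"
      using \<delta> by (simp add: field_simps)
    finally have "(\<Sum>j=1..m. peval (g j * (v j * v j)) x) \<le> \<delta> - N * penalty x"
      by simp
    moreover have "peval f x - N * penalty x \<le> peval s x"
      using s_bounds(1)[OF x] by (simp add: c_def)
    ultimately show ?thesis
      by (simp add: t_def)
  qed
  have "\<forall>\<^sub>F d in sequentially. \<forall>y. dominated d y \<longrightarrow> - \<delta> \<le> riesz y t"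
    by (rule eventually_dominated_nonneg) (use t_nonneg \<delta> in auto)
  moreover have "\<forall>\<^sub>F d in sequentially. \<forall>y. dominated d y \<longrightarrow> riesz y s \<le> (\<integral>x. peval s x \<partial>\<mu>) + \<delta>"
    by (rule eventually_dominated_le_integral) (use s_bounds \<delta> in auto)
  moreover have "\<forall>\<^sub>F d in sequentially. \<forall>j\<in>{1..m}.
      Poly_Mapping.keys (v j) \<subseteq> expos_upto (d - half_deg (g j))"
    by (intro eventually_ball_finite ballI eventually_keys_subset_expos_upto) auto
  ultimately show ?thesis
  proof eventually_elim
    case (elim d)
    show ?case
    proof (intro allI impI)
      fix y assume y: "constraints d y"
      then have dom: "dominated d y" by (simp add: constraints_def)
      have "0 \<le> riesz y (g j * (v j * v j))" if "j \<in> {1..m}" for j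
        using y elim(3) that unfolding constraints_def by (intro riesz_mult_square_nonneg) auto
      then have "0 \<le> (\<Sum>j=1..m. riesz y (g j * (v j * v j)))"
        by (rule sum_nonneg)
      moreover have "riesz y t = riesz y s - (\<Sum>j=1..m. riesz y (g j * (v j * v j))) - riesz y f + \<delta> * y 0"
        by (simp add: t_def riesz_add riesz_diff riesz_sum)
      moreover have "\<delta> * y 0 \<le> \<delta> * 1"
        using dominated_mass[OF dom] \<delta> by (intro mult_left_mono) auto
      moreover have "- \<delta> \<le> riesz y t" "riesz y s \<le> (\<integral>x. peval s x \<partial>\<mu>) + \<delta>"
        using elim dom by auto
      moreover have "(\<integral>x. peval s x \<partial>\<mu>) \<le> (\<integral>x. c x \<partial>\<mu>) + 2 * \<delta>"
      proof -
        have "(\<integral>x. peval s x - c x \<partial>\<mu>) \<le> 2 * \<delta>"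
          using s_bounds(2) B_subset \<delta>
          by (intro integral_le_bound integrable_continuous continuous_intros c_cont)
             (auto simp: algebra_simps)
        then show ?thesis
          by (subst (asm) Bochner_Integration.integral_diff)
             (auto intro!: integrable_continuous continuous_on_peval c_cont)
      qed
      ultimately show "riesz y f \<le> ?P + e"
        using N by (simp add: c_def \<delta>_def)
    qed
  qed
qed

section \<open>Convergence of near-optimal sequences\<close>

lemma AE_mu_K:
  assumes "AE x\<in>K in lborel. P x"
  shows "AE x in \<mu>. x \<in> K \<longrightarrow> P x"
proof -
  obtain Z where Z: "{x. \<not> (x \<in> K \<longrightarrow> P x)} \<subseteq> Z" "emeasure lborel Z = 0" "Z \<in> sets lborel"
    using AE_E[OF assms] by auto
  have "emeasure (restrict_space lborel B) (Z \<inter> B) = 0"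
    using Z emeasure_mono[of "Z \<inter> B" Z lborel] by (simp add: emeasure_restrict_space)
  then have "emeasure \<mu> (Z \<inter> B) = 0"
    by (simp add: normalized_lebesgue_def)
  moreover have "Z \<inter> B \<in> sets \<mu>"
    using Z by (auto simp: sets_mu sets_restrict_space)
  ultimately show ?thesis
    using Z(1) by (intro AE_I[of _ _ "Z \<inter> B"]) auto
qed

text \<open>
  The derivative of \<open>t \<mapsto> \<integral>\<^sub>K max 0 (p + t q)\<close> at 0 along \<open>t = 1 / (n + 1)\<close>. Where \<open>p > 0\<close> the
  positive part is inactive for small \<open>t\<close>, so the difference quotients converge to \<open>q\<close>, and
  they are bounded by \<open>\<bar>q\<bar>\<close> because the positive part is a contraction.
\<close>

lemma positive_part_derivative:
  fixes p q :: "real ^ 'n \<Rightarrow> real"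
  assumes pos: "AE x\<in>K in lborel. 0 < p x" and cont: "continuous_on UNIV p" "continuous_on UNIV q"
  shows "(\<lambda>n. real (Suc n) *
      ((LINT x:K|\<mu>. max 0 (p x + q x / real (Suc n))) - (LINT x:K|\<mu>. p x)))
    \<longlonglongrightarrow> (LINT x:K|\<mu>. q x)"
proof -
  define s where "s n x = indicator K x * (real (Suc n) * (max 0 (p x + q x / real (Suc n)) - p x))"
    for n x
  have "(\<lambda>n. \<integral>x. s n x \<partial>\<mu>) \<longlonglongrightarrow> (\<integral>x. indicator K x * q x \<partial>\<mu>)"
  proof (rule integral_dominated_convergence)
    show "integrable \<mu> (\<lambda>x. \<bar>q x\<bar>)"
      by (intro integrable_continuous continuous_intros cont)
    show "(\<lambda>x. indicator K x * q x) \<in> borel_measurable \<mu>"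
      by (intro borel_measurable_integrable integrable_K continuous_intros cont)
    show "s n \<in> borel_measurable \<mu>" for n
      unfolding s_def[abs_def]
      by (intro borel_measurable_integrable integrable_K continuous_intros cont) auto
    show "AE x in \<mu>. norm (s n x) \<le> \<bar>q x\<bar>" for n
      using AE_mu_K[OF pos]
    proof eventually_elim
      case (elim x)
      have contract: "\<bar>max 0 (a + t) - a\<bar> \<le> \<bar>t\<bar>" if "0 < a" for a t :: real
        using that by auto
      have "real (Suc n) * \<bar>max 0 (p x + q x / real (Suc n)) - p x\<bar> \<le>
          real (Suc n) * \<bar>q x / real (Suc n)\<bar>" if "0 < p x"
        by (intro mult_left_mono contract that) simp
      also have "\<dots> = \<bar>q x\<bar>"
        by simp
      finally show ?case
        using elim by (simp add: s_def indicator_def abs_mult)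
    qed
    show "AE x in \<mu>. (\<lambda>n. s n x) \<longlonglongrightarrow> indicator K x * q x"
      using AE_mu_K[OF pos]
    proof eventually_elim
      case (elim x)
      show ?case
      proof (cases "x \<in> K")
        case True
        then have px: "0 < p x" using elim by simp
        have "(\<lambda>n. p x + q x / real (Suc n)) \<longlonglongrightarrow> p x + 0"
          by (intro tendsto_intros LIMSEQ_Suc[OF lim_const_over_n])
        then have "\<forall>\<^sub>F n in sequentially. 0 < p x + q x / real (Suc n)"
          using px by (intro order_tendstoD(1)) auto
        then have "\<forall>\<^sub>F n in sequentially. s n x = indicator K x * q x"
        proof eventually_elim
          case (elim n)
          then have "max 0 (p x + q x / real (Suc n)) - p x = q x / real (Suc n)" by simp
          then show ?case by (simp add: s_def del: of_nat_Suc)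
        qed
        then show ?thesis by (rule tendsto_eventually)
      next
        case False
        then show ?thesis by (simp add: s_def)
      qed
    qed
  qed
  moreover have "(\<integral>x. s n x \<partial>\<mu>) = real (Suc n) *
      ((LINT x:K|\<mu>. max 0 (p x + q x / real (Suc n))) - (LINT x:K|\<mu>. p x))" for n
  proof -
    have "(\<integral>x. s n x \<partial>\<mu>) = (\<integral>x. real (Suc n) *
        (indicator K x * max 0 (p x + q x / real (Suc n)) - indicator K x * p x) \<partial>\<mu>)"
      by (simp add: s_def algebra_simps del: of_nat_Suc)
    also have "\<dots> = real (Suc n) *
      ((\<integral>x. indicator K x * max 0 (p x + q x / real (Suc n)) \<partial>\<mu>) - (\<integral>x. indicator K x * p x \<partial>\<mu>))"
      by (subst integral_mult_right_zero, subst Bochner_Integration.integral_diff)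
         (auto intro!: integrable_K continuous_intros cont simp del: of_nat_Suc)
    finally show ?thesis by (simp add: set_integral_K)
  qed
  ultimately show ?thesis
    by (simp add: set_integral_K)
qed

text \<open>
  A perturbation argument. Apply the bound by the positive part to \<open>p + q / k\<close> and subtract
  the integral of \<open>p\<close>, which is at most \<open>L(p)\<close>; multiplying by \<open>k\<close> bounds
  \<open>L(q)\<close> by a difference quotient, which is close to the integral of \<open>q\<close>.
\<close>

lemma eventually_near_optimal_le:
  fixes p q :: "'n mpoly"
  assumes pos: "AE x\<in>K in lborel. 0 < peval p x" and e: "0 < e"
  shows "\<forall>\<^sub>F d in sequentially. \<forall>y. constraints d y \<and> (LINT x:K|\<mu>. peval p x) \<le> riesz y p \<longrightarrow>
    riesz y q \<le> (LINT x:K|\<mu>. peval q x) + e"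
proof -
  let ?P = "LINT x:K|\<mu>. peval p x" and ?Q = "LINT x:K|\<mu>. peval q x"
  let ?I = "\<lambda>n. LINT x:K|\<mu>. max 0 (peval p x + peval q x / real (Suc n))"
  have "\<forall>\<^sub>F n in sequentially. real (Suc n) * (?I n - ?P) < ?Q + e / 2"
    using e by (intro order_tendstoD(2)[OF positive_part_derivative[OF pos]] continuous_on_peval) auto
  then obtain n where n: "real (Suc n) * (?I n - ?P) < ?Q + e / 2"
    by (auto simp: eventually_sequentially)
  define k where "k = real (Suc n)"
  have k: "0 < k" by (simp add: k_def)
  let ?f = "p + Poly_Mapping.single 0 (1 / k) * q"
  \<comment> \<open>The error \<open>e / (2 k)\<close> becomes \<open>e / 2\<close> after multiplication by \<open>k\<close>.\<close>
  have "\<forall>\<^sub>F d in sequentially. \<forall>y. constraints d y \<longrightarrow>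
      riesz y ?f \<le> (LINT x:K|\<mu>. max 0 (peval ?f x)) + e / (2 * k)"
    using e k by (intro eventually_le_positive_part) auto
  then show ?thesis
  proof eventually_elim
    case (elim d)
    show ?case
    proof (intro allI impI)
      fix y assume y: "constraints d y \<and> ?P \<le> riesz y p"
      then have "riesz y p + riesz y q / k \<le> ?I n + e / (2 * k)"
        using elim by (simp add: riesz_add riesz_scale k_def)
      then have "riesz y q / k \<le> (?I n - ?P) + e / (2 * k)"
        using y by linarith
      then have "riesz y q \<le> k * (?I n - ?P) + e / 2"
        using k by (simp add: field_simps)
      then show "riesz y q \<le> ?Q + e"
        using n unfolding k_def by linarith
    qed
  qed
qed

text \<open>
  The one-sided estimate for \<open>q\<close> and for \<open>- q\<close>.
\<close>

lemma near_optimal_tendsto: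
  fixes p q :: "'n mpoly"
  assumes pos: "AE x\<in>K in lborel. 0 < peval p x"
    and Y: "\<forall>\<^sub>F d in sequentially. constraints d (Y d) \<and> (LINT x:K|\<mu>. peval p x) \<le> riesz (Y d) p"
  shows "(\<lambda>d. riesz (Y d) q) \<longlonglongrightarrow> (LINT x:K|\<mu>. peval q x)"
proof (rule tendstoI)
  fix e :: real assume "0 < e"
  then have e: "0 < e / 2" by simp
  have neg: "(LINT x:K|\<mu>. peval (- q) x) = - (LINT x:K|\<mu>. peval q x)"
    by (simp add: set_integral_K peval_eq_riesz riesz_uminus)
  show "\<forall>\<^sub>F d in sequentially. dist (riesz (Y d) q) (LINT x:K|\<mu>. peval q x) < e"
    using Y eventually_near_optimal_le[OF pos e, of q] eventually_near_optimal_le[OF pos e, of "- q"]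
  proof eventually_elim
    case (elim d)
    have "riesz (Y d) q \<le> (LINT x:K|\<mu>. peval q x) + e / 2"
      "riesz (Y d) (- q) \<le> (LINT x:K|\<mu>. peval (- q) x) + e / 2"
      by (rule elim(2,3)[rule_format, OF elim(1)])+
    then show ?case
      using \<open>0 < e\<close> by (simp add: neg riesz_uminus dist_real_def abs_less_iff)
  qed
qed

section \<open>Optimal solutions\<close>

lemma min_order_ge:
  assumes "min_order g m p \<le> d"
  shows "half_deg p \<le> d" "j \<in> {1..m} \<Longrightarrow> half_deg (g j) \<le> d"
  using assms by (auto simp: min_order_def)

lemma keys_objective:
  "min_order g m p \<le> d \<Longrightarrow> Poly_Mapping.keys p \<subseteq> expos_upto (2 * d)"
  using min_order_ge(1)[of p d] total_deg_le_half_deg[of p]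
  by (intro keys_subset_expos_upto) auto

lemma feasible_K_moments:
  assumes "min_order g m p \<le> d"
  shows "feasible g m B d (restrict (weighted_moments (indicator K)) (expos_upto (2 * d)))"
  using min_order_ge(2)[OF assms] by (intro feasible_restrict[OF constraints_K_moments order_refl])

lemma optimal_iff:
  "optimal g m B p d y \<longleftrightarrow>
    feasible g m B d y \<and> (\<forall>z. feasible g m B d z \<longrightarrow> riesz z p \<le> riesz y p)"
  by (auto simp: optimal_def is_arg_max_def not_less)

lemma opt_value_eq: "optimal g m B p d y \<Longrightarrow> opt_value g m B p d = riesz y p"
  unfolding opt_value_def by (intro cSup_eq_maximum) (auto simp: optimal_iff)

lemma optimal_exists:
  assumes "min_order g m p \<le> d"
  shows "\<exists>y. optimal g m B p d y"
proof -
  have "{y. feasible g m B d y} \<noteq> {}"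
    using feasible_K_moments[OF assms] by blast
  from continuous_attains_sup[OF compact_feasible this
      continuous_on_subset[OF continuous_on_riesz subset_UNIV], of p]
  show ?thesis
    by (simp add: optimal_iff Bex_def)
qed

lemma optimal_ge:
  assumes "optimal g m B p d y" "min_order g m p \<le> d"
  shows "(LINT x:K|\<mu>. peval p x) \<le> riesz y p"
proof -
  have "riesz (restrict (weighted_moments (indicator K)) (expos_upto (2 * d))) p \<le> riesz y p"
    using assms(1) feasible_K_moments[OF assms(2)] unfolding optimal_iff by blast
  then show ?thesis
    by (simp only: riesz_restrict[OF keys_objective[OF assms(2)]] riesz_K_moments)
qed

lemma antimono_opt_value: "antimono_on {min_order g m p..} (opt_value g m B p)"
proof (rule monotone_onI)
  fix d d' assume d: "d \<in> {min_order g m p..}" "d' \<in> {min_order g m p..}" "d \<le> d'"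
  obtain y y' where y: "optimal g m B p d y" "optimal g m B p d' y'"
    using optimal_exists[of p d] optimal_exists[of p d'] d by auto
  have "feasible g m B d (restrict y' (expos_upto (2 * d)))"
    using y(2) d(1) unfolding optimal_iff feasible_iff[of d']
    by (intro feasible_restrict[OF _ d(3)] min_order_ge(2)) auto
  then have "riesz (restrict y' (expos_upto (2 * d))) p \<le> riesz y p"
    using y(1) by (simp add: optimal_iff)
  then show "opt_value g m B p d' \<le> opt_value g m B p d"
    using d by (simp add: opt_value_eq[OF y(1)] opt_value_eq[OF y(2)] riesz_restrict keys_objective)
qed

lemma optimal_riesz_tendsto:
  assumes pos: "AE x\<in>K in lborel. 0 < peval p x"
    and Y: "\<And>d. min_order g m p \<le> d \<Longrightarrow> optimal g m B p d (Y d)"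
  shows "(\<lambda>d. riesz (Y d) q) \<longlonglongrightarrow> (LINT x:K|\<mu>. peval q x)"
proof (rule near_optimal_tendsto[OF pos])
  show "\<forall>\<^sub>F d in sequentially. constraints d (Y d) \<and> (LINT x:K|\<mu>. peval p x) \<le> riesz (Y d) p"
    using eventually_ge_at_top[of "min_order g m p"]
  proof eventually_elim
    case (elim d)
    then show ?case
      using Y[OF elim] optimal_ge[OF Y[OF elim] elim] by (simp add: optimal_iff feasible_iff)
  qed
qed

end

theorem theorem3p2:
  fixes g :: "nat \<Rightarrow> 'n::finite mpoly" and m :: nat
    and p :: "'n mpoly" and B :: "(real ^ 'n) set"
  assumes "compact (semialg g m)"
    and "\<exists>a::real. ball_poly a \<in> quadratic_module g m"
    and "B \<in> sets borel"
    and "semialg g m \<subseteq> B"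
    and "B \<subseteq> cbox (- 1) 1"
    and "AE x\<in>semialg g m in lborel. peval p x > 0"
  shows "((\<forall>d\<ge>min_order g m p. \<exists>y. optimal g m B p d y) \<and>
      antimono_on {min_order g m p..} (opt_value g m B p) \<and>
      opt_value g m B p \<longlonglongrightarrow>
        (LINT x:semialg g m|normalized_lebesgue B. peval p x)) \<and>
    (\<forall>Y :: nat \<Rightarrow> 'n expo \<Rightarrow> real.
      (\<forall>d\<ge>min_order g m p. optimal g m B p d (Y d)) \<longrightarrow>
      (\<forall>\<alpha>. (\<lambda>d. Y d \<alpha>) \<longlonglongrightarrow>
        (LINT x:semialg g m|normalized_lebesgue B. expo_eval \<alpha> x)))"
proof -
  interpret moment_relaxation B g m
    by (intro moment_relaxation.intro unit_box_measure.intro moment_relaxation_axioms.intro assms)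
  have "opt_value g m B p \<longlonglongrightarrow> (LINT x:K|\<mu>. peval p x)"
  proof -
    obtain Y where Y: "\<And>d. min_order g m p \<le> d \<Longrightarrow> optimal g m B p d (Y d)"
      using optimal_exists by metis
    have "\<forall>\<^sub>F d in sequentially. riesz (Y d) p = opt_value g m B p d"
      using eventually_ge_at_top[of "min_order g m p"]
      by eventually_elim (simp add: opt_value_eq[OF Y])
    with optimal_riesz_tendsto[OF assms(6) Y] show ?thesis
      by (rule Lim_transform_eventually)
  qed
  moreover have "(\<lambda>d. Y d \<alpha>) \<longlonglongrightarrow> (LINT x:K|\<mu>. expo_eval \<alpha> x)"
    if "\<forall>d\<ge>min_order g m p. optimal g m B p d (Y d)" for Y \<alpha>
    using optimal_riesz_tendsto[OF assms(6), of Y "monom \<alpha>"] that by simp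
  ultimately show ?thesis
    using optimal_exists antimono_opt_value by blast
qed

end
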